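(* Let $f\colon\mathbb{R}^n\to\mathbb{R}$ be the composition of state transformations $$f(x) = e_{\ell}^T\,(\Phi_{\ell}\circ\Phi_{\ell-1}\circ\cdots\circ\Phi_1)(P^T x),$$ where the elemental functions $\phi_1,\ldots,\phi_\ell$ defining the state transformations $\Phi_1,\ldots,\Phi_\ell$ are twice continuously differentiable. Then the Hessian of $f$ is $$f'' = P\,\sum_{i=1}^{\ell}\left(\prod_{j=1}^{i-1}(\Phi'_j)^T\right)\left((\overline{\mathrm{v}}^i)^T\Phi''_i\right)\left(\prod_{j=1}^{i-1}\Phi'_{i-j}\right)P^T,$$ where $$(\overline{\mathrm{v}}^i)^T = e_\ell^T\prod_{j=1}^{\ell-i}\Phi'_{\ell-j+1},\qquad i=1,\ldots,\ell.$$
   Context: Let $n,\ell\ge 1$ be integers. Vectors of $\mathbb{R}^{n+\ell}$ have their components indexed by $1-n,2-n,\ldots,0,1,\ldots,\ell$, and vectors of $\mathbb{R}^n$ have theirs indexed by $1-n,\ldots,0$; the same shift of $-n$ is applied to the row and column indices of matrices. For each $i\in\{1,\ldots,\ell\}$ there is a set of predecessors of $i$, consisting of indices $j\in\{1-n,\ldots,i-1\}$; one writes $j\prec i$ if $j$ is a predecessor of $i$ (so $j\prec i$ implies $j<i$). The elemental (intermediate) function $\phi_i$ is a real-valued function of the variables $(y_j)_{j\prec i}$. The $i$-th state transformation is $$\Phi_i\colon\mathbb{R}^{n+\ell}\to\mathbb{R}^{n+\ell},\qquad \Phi_i(y)=(y_{1-n},\ldots,y_{i-1},\ \phi_i(y_j)_{j\prec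 i},\ y_{i+1},\ldots,y_\ell)^T,$$ i.e. it replaces component $i$ of $y$ by $\phi_i(y_j)_{j\prec i}$ and leaves the other components unchanged. $P$ is the $n\times(n+\ell)$ matrix whose leftmost $n\times n$ block is the identity and whose other entries are zero. $e_\ell\in\mathbb{R}^{n+\ell}$ is the last, i.e. the $(\ell+n)$-th, canonical vector (the one with a $1$ in the component with index $\ell$). $\Phi_k'$ denotes the Jacobian matrix of $\Phi_k$. Arguments are omitted: $\Phi_k'$ and $\Phi_k''$ are evaluated at $(\Phi_{k-1}\circ\cdots\circ\Phi_1)(P^Tx)$ (at $P^Tx$ for $k=1$), and $f''$ is evaluated at $x$. Vector-tensor product: for a twice continuously differentiable $\Psi=(\Psi_1,\ldots,\Psi_p)\colon\mathbb{R}^m\to\mathbb{R}^p$ and $y\in\mathbb{R}^p$, $y^T\Psi''$ denotes the $m\times m$ matrix $\sum_{r=1}^p y_r\Psi_r''$, where $\Psi_r''$ is the Hessian matrix of the component function $\Psi_r$. Thus $(\overline{\mathrm{v}}^i)^T\Phi_i''$ is the linear combination of the Hessians of the $n+\ell$ components of $\Phi_i$ with coefficients the components of $\overline{\mathrm{v}}^i$. Products of matrices $\prod_{j=a}^{b}A_j$ are ordered as $A_aA_{a+1}\cdots A_b$, and empty products are identity matrices. *)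

theory Defs
  imports "HOL-Analysis.Analysis"
begin

text \<open>
  The numbers \<open>n\<close> and \<open>\<ell>\<close> are \<open>CARD('n)\<close> and \<open>CARD('l)\<close> for arbitrary finite types \<open>'n\<close>, \<open>'l\<close>;
  only the cardinalities of these two types matter. Vectors are indexed by the
  integers \<open>1 - n, \<dots>, \<ell>\<close> (for \<open>\<real>\<^sup>n\<^sup>+\<^sup>\<ell>\<close>) and \<open>1 - n, \<dots>, 0\<close> (for \<open>\<real>\<^sup>n\<close>), so the index types are
  copies of these integer intervals.
\<close>

typedef ('n::finite, 'l::finite) state_index = "{1 - int CARD('n) .. int CARD('l)}"
  morphisms state_label state_idx
  by (rule exI[of _ 0]) (simp add: Suc_leI)

typedef 'n::finite input_index = "{1 - int CARD('n) .. 0}"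
  morphisms input_label input_idx
  by (rule exI[of _ 0]) (simp add: Suc_leI)

instance state_index :: (finite, finite) finite
proof
  have "inj (state_label :: ('a, 'b) state_index \<Rightarrow> int)"
    by (simp add: inj_on_def state_label_inject)
  moreover have "range (state_label :: ('a, 'b) state_index \<Rightarrow> int) \<subseteq> {1 - int CARD('a) .. int CARD('b)}"
    using state_label by blast
  ultimately show "finite (UNIV :: ('a, 'b) state_index set)"
    by (meson finite_atLeastAtMost_int finite_imageD finite_subset)
qed

instance input_index :: (finite) finite
proof
  have "inj (input_label :: 'a input_index \<Rightarrow> int)"
    by (simp add: inj_on_def input_label_inject)
  moreover have "range (input_label :: 'a input_index \<Rightarrow> int) \<subseteq> {1 - int CARD('a) .. 0}"
    using input_label by blast
  ultimately show "finite (UNIV :: 'a input_index set)"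
    by (meson finite_atLeastAtMost_int finite_imageD finite_subset)
qed

lemma card_state_index: "CARD(('n::finite, 'l::finite) state_index) = CARD('n) + CARD('l)"
  by (simp add: type_definition.card[OF type_definition_state_index] nat_add_distrib nat_diff_distrib)

lemma card_input_index: "CARD('n::finite input_index) = CARD('n)"
  by (simp add: type_definition.card[OF type_definition_input_index])

type_synonym ('n, 'l) state = "(real, ('n, 'l) state_index) vec"
type_synonym 'n input = "(real, 'n input_index) vec"

definition twice_continuously_differentiable :: "('a::real_normed_vector \<Rightarrow> real) \<Rightarrow> bool" where
  "twice_continuously_differentiable g \<longleftrightarrow>
     (\<exists>(g' :: 'a \<Rightarrow> 'a \<Rightarrow>\<^sub>L real) (g'' :: 'a \<Rightarrow> 'a \<Rightarrow>\<^sub>L 'a \<Rightarrow>\<^sub>L real).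
        (\<forall>x. (g has_derivative blinfun_apply (g' x)) (at x)) \<and>
        (\<forall>x. (g' has_derivative blinfun_apply (g'' x)) (at x)) \<and>
        continuous_on UNIV g'')"

definition partial_derivative :: "'m::finite \<Rightarrow> (real^'m \<Rightarrow> real) \<Rightarrow> real^'m \<Rightarrow> real" where
  "partial_derivative k g x = frechet_derivative g (at x) (axis k 1)"

definition hessian :: "(real^'m::finite \<Rightarrow> real) \<Rightarrow> real^'m \<Rightarrow> real^'m^'m" where
  "hessian g x = (\<chi> r c. partial_derivative r (partial_derivative c g) x)"

text \<open>\<open>vector_tensor y \<Psi> x\<close> is \<open>y\<^sup>T \<Psi>''\<close> with \<open>\<Psi>''\<close> evaluated at \<open>x\<close>.\<close>

definition vector_tensor ::
    "real^'p::finite \<Rightarrow> (real^'m::finite \<Rightarrow> real^'p) \<Rightarrow> real^'m \<Rightarrow> real^'m^'m" where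
  "vector_tensor y \<Psi> x = (\<Sum>r\<in>UNIV. (y $ r) *\<^sub>R hessian (\<lambda>z. \<Psi> z $ r) x)"

text \<open>\<open>matrix_prod A a b\<close> is \<open>A a ** A (a+1) ** \<dots> ** A b\<close>, and \<open>mat 1\<close> if \<open>b < a\<close>.\<close>

definition matrix_prod :: "(int \<Rightarrow> real^'m::finite^'m) \<Rightarrow> int \<Rightarrow> int \<Rightarrow> real^'m^'m" where
  "matrix_prod A a b = foldr (\<lambda>j M. A j ** M) [a..b] (mat 1)"

definition proj_matrix :: "real^('n::finite, 'l::finite) state_index^'n input_index" where
  "proj_matrix = (\<chi> r c. if input_label r = state_label c then 1 else 0)"

definition last_unit :: "('n::finite, 'l::finite) state" where
  "last_unit = axis (state_idx (int CARD('l))) 1"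

text \<open>
  An elemental function of the variables \<open>(y\<^sub>j)\<close>, \<open>j \<in> S\<close>, is represented as a function of the
  whole vector \<open>y\<close> that depends on these components only. It is twice continuously differentiable
  in the variables \<open>(y\<^sub>j)\<close>, \<open>j \<in> S\<close>, iff it is so as a function of \<open>y\<close>.
\<close>

definition depends_only_on :: "(real^'m::finite \<Rightarrow> real) \<Rightarrow> 'm set \<Rightarrow> bool" where
  "depends_only_on g S \<longleftrightarrow> (\<forall>y z. (\<forall>j\<in>S. y $ j = z $ j) \<longrightarrow> g y = g z)"

definition state_transformation ::
    "(int \<Rightarrow> ('n::finite, 'l::finite) state \<Rightarrow> real) \<Rightarrow> int \<Rightarrow> ('n, 'l) state \<Rightarrow> ('n, 'l) state" where
  "state_transformation \<phi> i y = (\<chi> k. if state_label k = i then \<phi> i y else y $ k)"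

text \<open>\<open>state_after \<Phi> k x\<close> is \<open>(\<Phi> k \<circ> \<dots> \<circ> \<Phi> 1) (P\<^sup>T x)\<close>, and \<open>P\<^sup>T x\<close> if \<open>k = 0\<close>.\<close>

definition state_after ::
    "(int \<Rightarrow> ('n::finite, 'l::finite) state \<Rightarrow> ('n, 'l) state) \<Rightarrow> int \<Rightarrow> 'n input \<Rightarrow> ('n, 'l) state" where
  "state_after \<Phi> k x = fold \<Phi> [1..k] (transpose proj_matrix *v x)"

definition state_jacobian ::
    "(int \<Rightarrow> ('n::finite, 'l::finite) state \<Rightarrow> ('n, 'l) state) \<Rightarrow> 'n input \<Rightarrow> int
      \<Rightarrow> real^('n, 'l) state_index^('n, 'l) state_index" where
  "state_jacobian \<Phi> x k = jacobian (\<Phi> k) (at (state_after \<Phi> (k - 1) x))"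

definition adjoint_vec ::
    "(int \<Rightarrow> ('n::finite, 'l::finite) state \<Rightarrow> ('n, 'l) state) \<Rightarrow> 'n input \<Rightarrow> int \<Rightarrow> ('n, 'l) state" where
  "adjoint_vec \<Phi> x i =
     last_unit v* matrix_prod (\<lambda>j. state_jacobian \<Phi> x (int CARD('l) - j + 1)) 1 (int CARD('l) - i)"

end

theory Submission
  imports Defs
begin

text \<open>
  Differentiating twice a scalar function \<open>g \<circ> \<Psi>\<close>, with \<open>J\<close> the Jacobian of \<open>\<Psi>\<close>, gives
  \<open>(g \<circ> \<Psi>)'' = J\<^sup>T g'' J + (\<nabla>g)\<^sup>T \<Psi>''\<close>: the outer curvature transported by \<open>J\<close>, plus the
  curvature of \<open>\<Psi>\<close> weighted by the gradient of \<open>g\<close> (\<open>second_order_chain_rule\<close>).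

  Let \<open>G\<^sub>k = e\<^sub>\<ell>\<^sup>T (\<Phi>\<^sub>\<ell> \<circ> \<dots> \<circ> \<Phi>\<^sub>k\<^sub>+\<^sub>1)\<close> be what remains to be evaluated after \<open>k\<close> transformations
  (\<open>output_from\<close>). Then \<open>G\<^sub>k\<^sub>-\<^sub>1 = G\<^sub>k \<circ> \<Phi>\<^sub>k\<close>. The first-order chain rule, run backwards from the linear
  function \<open>G\<^sub>\<ell>\<close>, identifies the gradient of \<open>G\<^sub>k\<close> at the \<open>k\<close>-th state with the adjoint vector
  (\<open>gradient_output_from\<close>). The second-order rule applied to the same decomposition splits the
  Hessian of \<open>G\<^sub>k\<^sub>-\<^sub>1\<close> into the congruence transform of the Hessian of \<open>G\<^sub>k\<close> under \<open>\<Phi>\<^sub>k'\<close> and the term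
  \<open>(v\<^sup>k)\<^sup>T \<Phi>\<^sub>k''\<close>. Unrolling this from \<open>G\<^sub>0\<close> onwards collects one summand per transformation, each
  between the Jacobians of the transformations before it (\<open>hessian_output_from_expansion\<close>). The
  remainder vanishes at \<open>k = \<ell>\<close>, because \<open>G\<^sub>\<ell>\<close> is linear. Finally \<open>f = G\<^sub>0 \<circ> P\<^sup>T\<close>, and composing with
  a linear map only multiplies the Hessian by \<open>P\<close> and \<open>P\<^sup>T\<close>.
\<close>

section \<open>Gradients and Hessians\<close>

definition gradient :: "(real^'m::finite \<Rightarrow> real) \<Rightarrow> real^'m \<Rightarrow> real^'m" where
  "gradient g x = (\<chi> k. partial_derivative k g x)"

lemma has_derivative_vec_nth_iff:
  "(F has_derivative F') (at x) \<longleftrightarrow> (\<forall>r. ((\<lambda>z. F z $ r) has_derivative (\<lambda>h. F' h $ r)) (at x))"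
  for F :: "'a::real_normed_vector \<Rightarrow> real^'p::finite"
  by (subst has_derivative_componentwise_within) (auto simp: Basis_vec_def inner_axis)

lemma gradient_eqI:
  assumes "(g has_derivative (\<lambda>h. d \<bullet> h)) (at x)"
  shows "gradient g x = d"
  unfolding gradient_def partial_derivative_def frechet_derivative_at[OF assms, symmetric]
  by (simp add: vec_eq_iff inner_axis)

text \<open>
  Row \<open>r\<close> of the Hessian is the derivative of the gradient in the coordinate direction \<open>r\<close>, so the
  differential of the gradient is multiplication by the Hessian from the left, \<open>h v* H\<close>.
\<close>

lemma hessian_eqI:
  assumes "(gradient g has_derivative (\<lambda>h. h v* H)) (at x)"
  shows "hessian g x = H"
proof -
  have "partial_derivative r (partial_derivative c g) x = H $ r $ c" for r c
  proof -
    have "((\<lambda>z. gradient g z $ c) has_derivative (\<lambda>h. (h v* H) $ c)) (at x)"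
      using assms by (subst (asm) has_derivative_vec_nth_iff) blast
    then have "(partial_derivative c g has_derivative (\<lambda>h. (h v* H) $ c)) (at x)"
      by (simp add: gradient_def)
    from frechet_derivative_at[OF this, symmetric] show ?thesis
      by (simp add: partial_derivative_def vector_matrix_mult_def axis_def if_distrib[of "\<lambda>t. t * _"] cong: if_cong)
  qed
  then show ?thesis
    by (simp add: hessian_def vec_eq_iff)
qed

lemma vector_matrix_mult_scaleR_right: "h v* (c *\<^sub>R A) = c *\<^sub>R (h v* A)"
  for A :: "real^'m::finite^'p::finite"
  by (simp add: vec_eq_iff vector_matrix_mult_def sum_distrib_left ac_simps)

text \<open>
  This and the lemma after it translate between the coordinate-free definition, with derivatives in
  spaces of bounded linear maps, and vectors and matrices, where the chain rule can be computed.
  Identifying a function \<open>D\<close> with the gradient and \<open>H\<close> with the Hessian at the same time means that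
  one differentiation settles smoothness and both formulas.
\<close>

lemma twice_continuously_differentiableI:
  fixes g :: "real^'m::finite \<Rightarrow> real"
  assumes D: "\<And>x. (g has_derivative (\<lambda>h. D x \<bullet> h)) (at x)"
    and H: "\<And>x. (D has_derivative (\<lambda>h. h v* H x)) (at x)"
    and cont: "continuous_on UNIV H"
  shows "twice_continuously_differentiable g" "gradient g = D" "hessian g = H"
proof -
  show grad: "gradient g = D"
    using gradient_eqI[OF D] by blast
  show "hessian g = H"
    by (rule ext, rule hessian_eqI) (simp only: grad H)
  \<comment> \<open>A matrix read as a bilinear form; continuity of \<open>H\<close> carries over because this reading is linear
     on a finite-dimensional space.\<close>
  define bil :: "real^'m^'m \<Rightarrow> (real^'m) \<Rightarrow>\<^sub>L (real^'m) \<Rightarrow>\<^sub>L real"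
    where "bil A = Blinfun (\<lambda>h. blinfun_inner_left (h v* A))" for A
  have bl: "bounded_linear (\<lambda>h. blinfun_inner_left (h v* A))" for A :: "real^'m^'m"
    using bounded_linear_compose[OF bounded_linear_blinfun_inner_left matrix_vector_mul_bounded_linear[of "transpose A"]]
    by simp
  have bil_apply: "blinfun_apply (bil A) h = blinfun_inner_left (h v* A)" for A h
    by (simp add: bil_def bounded_linear_Blinfun_apply[OF bl])
  have "linear bil"
    by (intro linearI blinfun_eqI)
      (simp_all add: bil_apply blinfun.add_left blinfun.scaleR_left vector_matrix_mult_add_rdistrib
        vector_matrix_mult_scaleR_right inner_add_right)
  then have "continuous_on UNIV (\<lambda>x. bil (H x))"
    by (intro linear_continuous_on_compose[OF cont])
  moreover have "((\<lambda>x. blinfun_inner_left (D x)) has_derivative blinfun_apply (bil (H x))) (at x)" for x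
    unfolding bil_apply
    by (rule bounded_linear.has_derivative[OF bounded_linear_blinfun_inner_left H])
  moreover have "(g has_derivative blinfun_apply (blinfun_inner_left (D x))) (at x)" for x
    using D by (simp add: blinfun_inner_left.rep_eq inner_commute)
  ultimately show "twice_continuously_differentiable g"
    unfolding twice_continuously_differentiable_def
    by (intro exI[of _ "\<lambda>x. blinfun_inner_left (D x)"] exI[of _ "\<lambda>x. bil (H x)"]) simp
qed

lemma twice_continuously_differentiableD:
  fixes g :: "real^'m::finite \<Rightarrow> real"
  assumes "twice_continuously_differentiable g"
  shows "(g has_derivative (\<lambda>h. gradient g x \<bullet> h)) (at x)"
    and "(gradient g has_derivative (\<lambda>h. h v* hessian g x)) (at x)"
    and "continuous_on UNIV (hessian g)"
proof -
  obtain g' :: "real^'m \<Rightarrow> (real^'m) \<Rightarrow>\<^sub>L real" and g'' :: "real^'m \<Rightarrow> (real^'m) \<Rightarrow>\<^sub>L (real^'m) \<Rightarrow>\<^sub>L real"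
    where g': "\<And>x. (g has_derivative blinfun_apply (g' x)) (at x)"
      and g'': "\<And>x. (g' has_derivative blinfun_apply (g'' x)) (at x)"
      and cont: "continuous_on UNIV g''"
    using assms unfolding twice_continuously_differentiable_def by blast
  define D where "D x = (\<chi> i. g' x (axis i 1))" for x
  define H where "H x = (\<chi> r c. g'' x (axis r 1) (axis c 1))" for x
  \<comment> \<open>Linear maps are determined by their values on the coordinate directions, so \<open>D\<close> and \<open>H\<close>
     represent all of \<open>g'\<close> and \<open>g''\<close>.\<close>
  have expand: "L h = (\<Sum>i\<in>UNIV. h $ i *\<^sub>R L (axis i 1))"
    if "linear L" for L :: "real^'m \<Rightarrow> 'b::real_vector" and h
  proof -
    have "L h = L (\<Sum>i\<in>UNIV. h $ i *\<^sub>R axis i 1)"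
      by (simp add: scalar_mult_eq_scaleR[symmetric] basis_expansion)
    also have "\<dots> = (\<Sum>i\<in>UNIV. h $ i *\<^sub>R L (axis i 1))"
      by (simp add: linear_sum[OF that] linear_cmul[OF that])
    finally show ?thesis .
  qed
  have lin: "linear (blinfun_apply L)" for L :: "(real^'m) \<Rightarrow>\<^sub>L 'b::real_normed_vector"
    by (simp add: blinfun.bounded_linear_right bounded_linear.linear)
  have D: "(g has_derivative (\<lambda>h. D x \<bullet> h)) (at x)" for x
  proof -
    have "blinfun_apply (g' x) = (\<lambda>h. D x \<bullet> h)"
      by (rule ext, subst expand[OF lin]) (simp add: D_def inner_vec_def mult.commute)
    then show ?thesis using g'[of x] by simp
  qed
  have H: "(D has_derivative (\<lambda>h. h v* H x)) (at x)" for x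
  proof (subst has_derivative_vec_nth_iff, rule allI)
    fix r
    have "((\<lambda>z. g' z (axis r 1)) has_derivative (\<lambda>h. g'' x h (axis r 1))) (at x)"
      using g'' by (auto intro!: derivative_eq_intros)
    moreover have "g'' x h (axis r 1) = (h v* H x) $ r" for h
      by (subst expand[OF lin])
        (simp add: H_def vector_matrix_mult_def blinfun.sum_left blinfun.scaleR_left mult.commute)
    ultimately show "((\<lambda>z. D z $ r) has_derivative (\<lambda>h. (h v* H x) $ r)) (at x)"
      by (simp add: D_def)
  qed
  have "continuous_on UNIV H"
    unfolding H_def by (intro continuous_intros cont)
  with twice_continuously_differentiableI[OF D H] D H
  show "(g has_derivative (\<lambda>h. gradient g x \<bullet> h)) (at x)"
    and "(gradient g has_derivative (\<lambda>h. h v* hessian g x)) (at x)"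
    and "continuous_on UNIV (hessian g)"
    by simp_all
qed

lemma twice_continuously_differentiable_inner:
  fixes d :: "real^'m::finite"
  shows "twice_continuously_differentiable (\<lambda>x. d \<bullet> x)" "gradient (\<lambda>x. d \<bullet> x) = (\<lambda>_. d)"
    "hessian (\<lambda>x. d \<bullet> x) = (\<lambda>_. 0)"
proof -
  have *: "((\<lambda>_. d) has_derivative (\<lambda>h. h v* (0 :: real^'m^'m))) (at x)" for x :: "real^'m"
    by simp
  have D: "((\<lambda>x. d \<bullet> x) has_derivative (\<lambda>h. d \<bullet> h)) (at x)" for x
    by (simp add: bounded_linear_imp_has_derivative bounded_linear_inner_right)
  show "twice_continuously_differentiable (\<lambda>x. d \<bullet> x)" "gradient (\<lambda>x. d \<bullet> x) = (\<lambda>_. d)"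
    "hessian (\<lambda>x. d \<bullet> x) = (\<lambda>_. 0)"
    using twice_continuously_differentiableI[OF D *] by simp_all
qed

section \<open>The second-order chain rule\<close>

lemma jacobian_of_twice_continuously_differentiable:
  fixes \<Psi> :: "real^'m::finite \<Rightarrow> real^'p::finite"
  assumes "\<And>r. twice_continuously_differentiable (\<lambda>x. \<Psi> x $ r)"
  shows "(\<Psi> has_derivative (\<lambda>h. jacobian \<Psi> (at x) *v h)) (at x)"
    and "jacobian \<Psi> (at x) $ r = gradient (\<lambda>x. \<Psi> x $ r) x"
proof -
  define J :: "real^'m^'p" where "J = (\<chi> r. gradient (\<lambda>x. \<Psi> x $ r) x)"
  have D: "(\<Psi> has_derivative (\<lambda>h. J *v h)) (at x)"
    by (subst has_derivative_vec_nth_iff)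
      (simp add: J_def matrix_vector_mul_component twice_continuously_differentiableD(1)[OF assms])
  have "jacobian \<Psi> (at x) = J"
    unfolding jacobian_def frechet_derivative_at[OF D, symmetric] by simp
  with D show "(\<Psi> has_derivative (\<lambda>h. jacobian \<Psi> (at x) *v h)) (at x)"
    and "jacobian \<Psi> (at x) $ r = gradient (\<lambda>x. \<Psi> x $ r) x"
    by (simp_all add: J_def)
qed

lemma vector_matrix_mult_eq_sum_rows: "w v* A = (\<Sum>r\<in>UNIV. w $ r *\<^sub>R A $ r)"
  for A :: "real^'m::finite^'p::finite"
  by (simp add: vec_eq_iff vector_matrix_mult_def sum_component mult.commute)

lemma vector_matrix_mult_sum: "h v* (\<Sum>r\<in>S. A r) = (\<Sum>r\<in>S. h v* A r)"
  for A :: "'i \<Rightarrow> real^'m::finite^'p::finite"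
  by (induction S rule: infinite_finite_induct)
    (simp_all add: vector_matrix_mult_add_rdistrib)

text \<open>
  The gradient of the composition is \<open>\<Sum>\<^sub>r (\<nabla>g)\<^sub>r \<nabla>\<Psi>\<^sub>r\<close>, with \<open>\<nabla>g\<close> taken at \<open>\<Psi> x\<close>. By the product rule,
  differentiating the factors \<open>\<nabla>\<Psi>\<^sub>r\<close> gives the vector-tensor product, and differentiating the factors
  \<open>(\<nabla>g)\<^sub>r\<close> gives a linear combination of the rows \<open>\<nabla>\<Psi>\<^sub>r\<close> of the Jacobian, which is the congruence
  transform of the Hessian of \<open>g\<close>.
\<close>

lemma second_order_chain_rule:
  fixes g :: "real^'p::finite \<Rightarrow> real" and \<Psi> :: "real^'m::finite \<Rightarrow> real^'p"
  assumes g: "twice_continuously_differentiable g"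
    and \<Psi>: "\<And>r. twice_continuously_differentiable (\<lambda>x. \<Psi> x $ r)"
  shows "twice_continuously_differentiable (\<lambda>x. g (\<Psi> x))"
    and "gradient (\<lambda>x. g (\<Psi> x)) x = gradient g (\<Psi> x) v* jacobian \<Psi> (at x)"
    and "hessian (\<lambda>x. g (\<Psi> x)) x =
      transpose (jacobian \<Psi> (at x)) ** hessian g (\<Psi> x) ** jacobian \<Psi> (at x)
        + vector_tensor (gradient g (\<Psi> x)) \<Psi> x"
proof -
  define J where "J x = jacobian \<Psi> (at x)" for x
  define D where "D x = gradient g (\<Psi> x) v* J x" for x
  define H where "H x = transpose (J x) ** hessian g (\<Psi> x) ** J x
      + vector_tensor (gradient g (\<Psi> x)) \<Psi> x" for x
  have \<Psi>': "(\<Psi> has_derivative (\<lambda>h. J x *v h)) (at x)" for x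
    unfolding J_def by (rule jacobian_of_twice_continuously_differentiable(1)[OF \<Psi>])
  have J_row: "J x $ r = gradient (\<lambda>x. \<Psi> x $ r) x" for x r
    unfolding J_def by (rule jacobian_of_twice_continuously_differentiable(2)[OF \<Psi>])
  have D_deriv: "((\<lambda>x. g (\<Psi> x)) has_derivative (\<lambda>h. D x \<bullet> h)) (at x)" for x
    using has_derivative_compose[OF \<Psi>' twice_continuously_differentiableD(1)[OF g]]
    by (simp add: D_def dot_lmul_matrix)
  have g'': "((\<lambda>x. gradient g (\<Psi> x)) has_derivative (\<lambda>h. (J x *v h) v* hessian g (\<Psi> x))) (at x)" for x
    by (rule has_derivative_compose[OF \<Psi>' twice_continuously_differentiableD(2)[OF g]])
  have H_deriv: "(D has_derivative (\<lambda>h. h v* H x)) (at x)" for x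
  proof -
    have "((\<lambda>x. \<Sum>r\<in>UNIV. gradient g (\<Psi> x) $ r *\<^sub>R gradient (\<lambda>x. \<Psi> x $ r) x) has_derivative
        (\<lambda>h. \<Sum>r\<in>UNIV. gradient g (\<Psi> x) $ r *\<^sub>R (h v* hessian (\<lambda>x. \<Psi> x $ r) x)
          + ((J x *v h) v* hessian g (\<Psi> x)) $ r *\<^sub>R gradient (\<lambda>x. \<Psi> x $ r) x)) (at x)"
      using g''[of x, unfolded has_derivative_vec_nth_iff]
      by (intro has_derivative_sum has_derivative_scaleR twice_continuously_differentiableD(2)[OF \<Psi>]) blast+
    also have "(\<lambda>x. \<Sum>r\<in>UNIV. gradient g (\<Psi> x) $ r *\<^sub>R gradient (\<lambda>x. \<Psi> x $ r) x) = D"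
      by (simp add: fun_eq_iff D_def vector_matrix_mult_eq_sum_rows J_row)
    also have "(\<lambda>h. \<Sum>r\<in>UNIV. gradient g (\<Psi> x) $ r *\<^sub>R (h v* hessian (\<lambda>x. \<Psi> x $ r) x)
          + ((J x *v h) v* hessian g (\<Psi> x)) $ r *\<^sub>R gradient (\<lambda>x. \<Psi> x $ r) x) = (\<lambda>h. h v* H x)"
    proof
      fix h
      have "h v* H x = ((J x *v h) v* hessian g (\<Psi> x)) v* J x
          + h v* vector_tensor (gradient g (\<Psi> x)) \<Psi> x"
        by (simp add: H_def vector_matrix_mult_add_rdistrib vector_matrix_mul_assoc[symmetric])
      then show "(\<Sum>r\<in>UNIV. gradient g (\<Psi> x) $ r *\<^sub>R (h v* hessian (\<lambda>x. \<Psi> x $ r) x)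
          + ((J x *v h) v* hessian g (\<Psi> x)) $ r *\<^sub>R gradient (\<lambda>x. \<Psi> x $ r) x) = h v* H x"
        by (simp add: vector_tensor_def vector_matrix_mult_sum vector_matrix_mult_eq_sum_rows[of _ "J x"]
            J_row sum.distrib add.commute vector_matrix_mult_scaleR_right)
    qed
    finally show ?thesis .
  qed
  have "continuous_on UNIV J"
  proof -
    have "continuous_on UNIV (\<lambda>x. J x $ r)" for r
      unfolding J_row
      by (rule has_derivative_continuous_on, rule twice_continuously_differentiableD(2)[OF \<Psi>])
    then show ?thesis
      using continuous_on_vec_lambda[of UNIV "\<lambda>r x. J x $ r"] by simp
  qed
  moreover have "continuous_on UNIV \<Psi>"
    by (rule has_derivative_continuous_on, rule \<Psi>')
  moreover have "continuous_on UNIV (\<lambda>x. gradient g (\<Psi> x))"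
    by (rule has_derivative_continuous_on, rule g'')
  moreover have "continuous_on UNIV (\<lambda>x. hessian g (\<Psi> x))"
    by (rule continuous_on_compose2[OF twice_continuously_differentiableD(3)[OF g] \<open>continuous_on UNIV \<Psi>\<close>]) simp
  ultimately have "continuous_on UNIV H"
    unfolding H_def vector_tensor_def matrix_matrix_mult_def transpose_def
    by (intro continuous_intros twice_continuously_differentiableD(3)[OF \<Psi>]) auto
  from twice_continuously_differentiableI[OF D_deriv H_deriv this]
  show "twice_continuously_differentiable (\<lambda>x. g (\<Psi> x))"
    and "gradient (\<lambda>x. g (\<Psi> x)) x = gradient g (\<Psi> x) v* jacobian \<Psi> (at x)"
    and "hessian (\<lambda>x. g (\<Psi> x)) x =
      transpose (jacobian \<Psi> (at x)) ** hessian g (\<Psi> x) ** jacobian \<Psi> (at x)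
        + vector_tensor (gradient g (\<Psi> x)) \<Psi> x"
    by (simp_all add: D_def H_def J_def)
qed

lemma matrix_vector_mult_twice_continuously_differentiable:
  fixes A :: "real^'m::finite^'p::finite"
  shows "twice_continuously_differentiable (\<lambda>x. (A *v x) $ r)"
    and "jacobian ((*v) A) (at x) = A" and "vector_tensor y ((*v) A) x = 0"
proof -
  show "twice_continuously_differentiable (\<lambda>x. (A *v x) $ r)"
    by (simp add: matrix_vector_mul_component twice_continuously_differentiable_inner)
  have "((*v) A has_derivative (*v) A) (at x)"
    by (simp add: bounded_linear_imp_has_derivative)
  from frechet_derivative_at[OF this, symmetric] show "jacobian ((*v) A) (at x) = A"
    by (simp add: jacobian_def)
  show "vector_tensor y ((*v) A) x = 0"
    by (simp add: vector_tensor_def matrix_vector_mul_component twice_continuously_differentiable_inner)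
qed

section \<open>Ordered products of matrices\<close>

lemma matrix_prod_first:
  "a \<le> b \<Longrightarrow> matrix_prod A a b = A a ** matrix_prod A (a + 1) b"
  by (simp add: matrix_prod_def upto_rec1)

lemma matrix_prod_last:
  assumes "a \<le> b"
  shows "matrix_prod A a b = matrix_prod A a (b - 1) ** A b"
proof -
  have *: "foldr (\<lambda>j M. A j ** M) js N = foldr (\<lambda>j M. A j ** M) js (mat 1) ** N" for js N
    by (induction js) (simp_all add: matrix_mul_assoc)
  have "matrix_prod A a b = foldr (\<lambda>j M. A j ** M) [a..b - 1] (A b)"
    using assms by (simp add: matrix_prod_def upto_rec2)
  then show ?thesis
    by (metis * matrix_prod_def)
qed

lemma matrix_prod_shift: "matrix_prod A (a + 1) (b + 1) = matrix_prod (\<lambda>j. A (j + 1)) a b"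
proof -
  have "[a + 1..b + 1] = map (\<lambda>j. j + 1) [a..b]"
    by (rule nth_equalityI) auto
  then show ?thesis
    by (simp add: matrix_prod_def foldr_map o_def)
qed

lemma matrix_mult_add_left: "(A + B) ** C = A ** C + B ** C"
  for A B :: "real^'m::finite^'p::finite" and C :: "real^'q::finite^'m"
  by (simp add: vec_eq_iff matrix_matrix_mult_def distrib_right sum.distrib)

section \<open>Propagation along the evaluation sequence\<close>

text \<open>
  The output as a function of the state after \<open>k\<close> transformations. For \<open>k = \<ell>\<close> the list of remaining
  transformations is empty and only the last component is read off.
\<close>

definition output_from ::
    "(int \<Rightarrow> ('n::finite, 'l::finite) state \<Rightarrow> ('n, 'l) state) \<Rightarrow> int \<Rightarrow> ('n, 'l) state \<Rightarrow> real" where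
  "output_from \<Phi> k z = last_unit \<bullet> fold \<Phi> [k + 1..int CARD('l)] z"

lemma output_from_final: "output_from \<Phi> (int CARD('l)) = (\<lambda>z. last_unit \<bullet> z)"
  for \<Phi> :: "int \<Rightarrow> ('n::finite, 'l::finite) state \<Rightarrow> ('n, 'l) state"
  by (simp add: output_from_def fun_eq_iff)

lemma output_from_step:
  fixes \<Phi> :: "int \<Rightarrow> ('n::finite, 'l::finite) state \<Rightarrow> ('n, 'l) state"
  assumes "k \<le> int CARD('l)"
  shows "output_from \<Phi> (k - 1) = (\<lambda>z. output_from \<Phi> k (\<Phi> k z))"
  using assms by (simp add: output_from_def fun_eq_iff upto_rec1)

lemma state_after_step: "1 \<le> k \<Longrightarrow> state_after \<Phi> k x = \<Phi> k (state_after \<Phi> (k - 1) x)"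
  by (simp add: state_after_def upto_rec2)

lemma state_transformation_twice_continuously_differentiable:
  assumes "twice_continuously_differentiable (\<phi> i)"
  shows "twice_continuously_differentiable (\<lambda>y. state_transformation \<phi> i y $ r)"
proof (cases "state_label r = i")
  case True
  with assms show ?thesis
    by (simp add: state_transformation_def)
next
  case False
  then have "(\<lambda>y. state_transformation \<phi> i y $ r) = (\<lambda>y. axis r 1 \<bullet> y)"
    by (simp add: state_transformation_def inner_axis' fun_eq_iff)
  then show ?thesis
    by (simp add: twice_continuously_differentiable_inner)
qed

context
  fixes \<Phi> :: "int \<Rightarrow> ('n::finite, 'l::finite) state \<Rightarrow> ('n, 'l) state"
  assumes \<Phi>: "\<And>i r. i \<in> {1..int CARD('l)} \<Longrightarrow> twice_continuously_differentiable (\<lambda>y. \<Phi> i y $ r)"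
begin

lemma output_from_twice_continuously_differentiable:
  assumes "k \<le> int CARD('l)" "0 \<le> k"
  shows "twice_continuously_differentiable (output_from \<Phi> k)"
  using assms
proof (induction k rule: int_le_induct)
  case base
  show ?case
    by (simp add: output_from_final twice_continuously_differentiable_inner)
next
  case (step k)
  then show ?case
    by (simp add: output_from_step second_order_chain_rule(1) \<Phi>)
qed

text \<open>
  Reverse mode: each backward step multiplies the gradient by one more Jacobian on the right, which is
  how the product defining the adjoint vector grows when its index decreases.
\<close>

lemma gradient_output_from:
  assumes "k \<le> int CARD('l)" "0 \<le> k"
  shows "gradient (output_from \<Phi> k) (state_after \<Phi> k x) = adjoint_vec \<Phi> x k"
  using assms
proof (induction k rule: int_le_induct)
  case base
  show ?case
    by (simp add: output_from_final twice_continuously_differentiable_inner adjoint_vec_def matrix_prod_def)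
next
  case (step k)
  have "gradient (output_from \<Phi> (k - 1)) (state_after \<Phi> (k - 1) x)
      = gradient (output_from \<Phi> k) (state_after \<Phi> k x) v* state_jacobian \<Phi> x k"
    using step
    by (simp add: output_from_step second_order_chain_rule(2) \<Phi>
        output_from_twice_continuously_differentiable state_jacobian_def state_after_step[of k])
  also have "\<dots> = adjoint_vec \<Phi> x k v* state_jacobian \<Phi> x k"
    using step by simp
  also have "\<dots> = adjoint_vec \<Phi> x (k - 1)"
    using step
    by (simp add: adjoint_vec_def vector_matrix_mul_assoc matrix_prod_last[of 1 "int CARD('l) - (k - 1)"])
  finally show ?case .
qed

text \<open>
  Stopping after \<open>k\<close> transformations leaves a remainder with the Hessian of the part not yet
  unrolled. One more application of the chain rule splits this remainder into the next summand, which
  keeps the \<open>k\<close> Jacobians accumulated on either side, and the next remainder, which acquires one more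
  Jacobian on either side.
\<close>

lemma hessian_output_from_expansion:
  assumes "0 \<le> k" "k \<le> int CARD('l)"
  shows "hessian (output_from \<Phi> 0) (state_after \<Phi> 0 x) =
    (\<Sum>i = 1..k.
        matrix_prod (\<lambda>j. transpose (state_jacobian \<Phi> x j)) 1 (i - 1) **
        vector_tensor (adjoint_vec \<Phi> x i) (\<Phi> i) (state_after \<Phi> (i - 1) x) **
        matrix_prod (\<lambda>j. state_jacobian \<Phi> x (i - j)) 1 (i - 1)) +
    matrix_prod (\<lambda>j. transpose (state_jacobian \<Phi> x j)) 1 k **
      hessian (output_from \<Phi> k) (state_after \<Phi> k x) **
      matrix_prod (\<lambda>j. state_jacobian \<Phi> x (k + 1 - j)) 1 k"
  using assms
proof (induction k rule: int_ge_induct)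
  case base
  show ?case
    by (simp add: matrix_prod_def)
next
  case (step k)
  let ?S = "state_jacobian \<Phi> x"
  let ?L = "matrix_prod (\<lambda>j. transpose (?S j)) 1"
  let ?R = "\<lambda>k. matrix_prod (\<lambda>j. ?S (k + 1 - j)) 1 k"
  let ?H = "\<lambda>k. hessian (output_from \<Phi> k) (state_after \<Phi> k x)"
  let ?T = "\<lambda>i. vector_tensor (adjoint_vec \<Phi> x i) (\<Phi> i) (state_after \<Phi> (i - 1) x)"
  have H: "?H k = transpose (?S (k + 1)) ** ?H (k + 1) ** ?S (k + 1) + ?T (k + 1)"
    using step second_order_chain_rule(3)[of "output_from \<Phi> (k + 1)" "\<Phi> (k + 1)" "state_after \<Phi> k x"]
      gradient_output_from[of "k + 1" x] output_from_step[of "k + 1" \<Phi>]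
    by (simp add: \<Phi> output_from_twice_continuously_differentiable state_jacobian_def
        state_after_step[of "k + 1"])
  have L: "?L (k + 1) = ?L k ** transpose (?S (k + 1))"
    using step by (simp add: matrix_prod_last)
  have "?R (k + 1) = ?S (k + 1 + 1 - 1) ** matrix_prod (\<lambda>j. ?S (k + 1 + 1 - j)) (1 + 1) (k + 1)"
    by (rule matrix_prod_first) (use step in simp)
  \<comment> \<open>The reversed product depends on its upper end through the shift in \<open>k + 1 - j\<close>; splitting off
     the first factor and renumbering the others restores this shift for \<open>k\<close>.\<close>
  then have R: "?R (k + 1) = ?S (k + 1) ** ?R k"
    by (simp only: matrix_prod_shift add_diff_cancel_right add_diff_cancel_right')
  have "?L k ** ?H k ** ?R k = ?L (k + 1) ** ?H (k + 1) ** ?R (k + 1) + ?L k ** ?T (k + 1) ** ?R k"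
    unfolding H L R
    by (simp add: matrix_add_ldistrib matrix_mult_add_left matrix_mul_assoc)
  moreover have "{1..k + 1} = insert (k + 1) {1..k}"
    using step by auto
  ultimately show ?case
    using step by (simp add: add.commute add.left_commute)
qed

end

theorem corollary4p3:
  fixes predecessors :: "int \<Rightarrow> ('n::finite, 'l::finite) state_index set"
    and \<phi> :: "int \<Rightarrow> ('n, 'l) state \<Rightarrow> real"
    and \<Phi> :: "int \<Rightarrow> ('n, 'l) state \<Rightarrow> ('n, 'l) state"
    and f :: "'n input \<Rightarrow> real"
  assumes predecessors: "\<And>i j. i \<in> {1..int CARD('l)} \<Longrightarrow> j \<in> predecessors i \<Longrightarrow> state_label j < i"
    and elemental: "\<And>i. i \<in> {1..int CARD('l)} \<Longrightarrow> depends_only_on (\<phi> i) (predecessors i)"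
    and C2: "\<And>i. i \<in> {1..int CARD('l)} \<Longrightarrow> twice_continuously_differentiable (\<phi> i)"
    and transformations: "\<And>i. i \<in> {1..int CARD('l)} \<Longrightarrow> \<Phi> i = state_transformation \<phi> i"
    and f: "\<And>x. f x = last_unit \<bullet> state_after \<Phi> (int CARD('l)) x"
  shows "twice_continuously_differentiable f \<and>
    (\<forall>x. hessian f x =
      proj_matrix **
      (\<Sum>i = 1..int CARD('l).
          matrix_prod (\<lambda>j. transpose (state_jacobian \<Phi> x j)) 1 (i - 1) **
          vector_tensor (adjoint_vec \<Phi> x i) (\<Phi> i) (state_after \<Phi> (i - 1) x) **
          matrix_prod (\<lambda>j. state_jacobian \<Phi> x (i - j)) 1 (i - 1)) **
      transpose (proj_matrix :: real^('n, 'l) state_index^'n input_index))"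
proof -
  let ?P = "proj_matrix :: real^('n, 'l) state_index^'n input_index"
  have \<Phi>: "twice_continuously_differentiable (\<lambda>y. \<Phi> i y $ r)" if "i \<in> {1..int CARD('l)}" for i r
    using that by (simp add: transformations state_transformation_twice_continuously_differentiable C2)
  have f_eq: "f = (\<lambda>x. output_from \<Phi> 0 (transpose ?P *v x))"
    by (simp add: fun_eq_iff f output_from_def state_after_def)
  have C2_out: "twice_continuously_differentiable (output_from \<Phi> 0)"
    by (rule output_from_twice_continuously_differentiable) (simp_all add: \<Phi>)
  note chain = second_order_chain_rule[OF C2_out
      matrix_vector_mult_twice_continuously_differentiable(1)[of "transpose ?P"]]
  have "hessian f x = ?P ** hessian (output_from \<Phi> 0) (state_after \<Phi> 0 x) ** transpose ?P" for x
    using chain(3)[of x]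
    by (simp add: f_eq matrix_vector_mult_twice_continuously_differentiable(2,3) state_after_def
        del: transpose_matrix_vector)
  \<comment> \<open>Unrolled completely, the remainder contains the Hessian of a linear function.\<close>
  moreover have "hessian (output_from \<Phi> 0) (state_after \<Phi> 0 x) =
      (\<Sum>i = 1..int CARD('l).
          matrix_prod (\<lambda>j. transpose (state_jacobian \<Phi> x j)) 1 (i - 1) **
          vector_tensor (adjoint_vec \<Phi> x i) (\<Phi> i) (state_after \<Phi> (i - 1) x) **
          matrix_prod (\<lambda>j. state_jacobian \<Phi> x (i - j)) 1 (i - 1))" for x
    by (subst hessian_output_from_expansion[where k = "int CARD('l)"])
      (simp_all add: \<Phi> output_from_final twice_continuously_differentiable_inner)
  moreover have "twice_continuously_differentiable f"
    unfolding f_eq by (rule chain(1))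
  ultimately show ?thesis
    by simp
qed

end
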